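(* For integers $r\ge 1$, $t\ge 2$, $u\ge 0$, and $0\le z\le \frac{q^r-1}{2(q-1)}$ with $k=\frac{q^r-1}{q-1}+1-z+u>r$ we have $\mathrm{A}_q(v,2k;k)\le lq^k+1+z(q-1)$, where $l=\frac{q^{v-k}-q^r}{q^k-1}$ and $v=kt+r$.
   Context: $q>1$ is a prime power. $\mathrm{A}_q(v,2k;k)$ denotes the maximum size of a partial $k$-spread in $\mathbb{F}_q^v$, i.e. of a set of $k$-dimensional subspaces of $\mathbb{F}_q^v$ with pairwise trivial (zero) intersection. *)

theory Defs
  imports "HOL-Analysis.Analysis"
begin

definition partial_spread :: "nat \<Rightarrow> ('a::field ^ 'n::finite) set set \<Rightarrow> bool" where
  "partial_spread k P \<longleftrightarrow>
     (\<forall>U\<in>P. vec.subspace U \<and> vec.dim U = k) \<and> pairwise (\<lambda>U W. U \<inter> W = {0}) P"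

(* For q = CARD('a) and v = CARD('n) this is A_q(v,2k;k): a field with q elements is unique
   up to isomorphism, so it depends on the types only through their cardinalities. *)
definition max_partial_spread :: "('a::{field,finite} ^ 'n::finite) itself \<Rightarrow> nat \<Rightarrow> nat" where
  "max_partial_spread T k = Max (card ` {P :: ('a ^ 'n) set set. partial_spread k P})"

(* The Max above ranges over a finite nonempty set, hence is a genuine maximum. *)
lemma finite_partial_spreads: "finite {P :: ('a::{field,finite} ^ 'n::finite) set set. partial_spread k P}"
  by simp

lemma partial_spread_empty: "partial_spread k {}"
  by (simp add: partial_spread_def)

end

theory Submission
  imports Defs "HOL-Number_Theory.Cong"
begin

text \<open>
  Suppose that there is a partial spread of size \<open>l q\<^sup>k + 1 + w\<close> with \<open>w = 1 + z (q - 1)\<close>, and let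
  \<open>M\<close> be the set of nonzero vectors it leaves uncovered. In a subspace \<open>U\<close> cut out by \<open>j\<close> linear
  equations, the number of uncovered vectors is congruent to \<open>w\<close> modulo \<open>q\<close> to the power \<open>k - j\<close> and
  divisible by \<open>q - 1\<close>, so it has the form \<open>w + (a (q - 1) - 1) Y\<close>, where \<open>Y\<close> is that power of \<open>q\<close>.
  Averaging over one further equation shows that the equation can be chosen such that \<open>a\<close>
  drops by at least one. As \<open>a = k - 1 - u\<close> for \<open>j = 0\<close>, after \<open>j = k - 1 - z\<close> steps \<open>a \<le> z\<close>; there
  are enough steps because \<open>2 z (q - 1) \<le> q\<^sup>r - 1\<close> makes \<open>z < k\<close>. The values which one more
  equation can produce lie on a lattice of step \<open>(q - 1) Y / q\<close>, so a quadratic polynomial with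
  consecutive lattice points as roots is nonnegative at all of them. Its average over all
  equations is computed from the first two moments, which gives
  \<open>2 Y \<le> w (w + 1)\<close> with \<open>Y = q q\<^sup>z\<close>. This contradicts the binomial expansion of \<open>Y\<close>.
\<close>

section \<open>Linear equations and cardinalities of finite vector spaces\<close>

definition dot :: "'a::comm_semiring_0 ^ 'n::finite \<Rightarrow> 'a ^ 'n \<Rightarrow> 'a" where
  "dot x y = (\<Sum>i\<in>UNIV. x $ i * y $ i)"

lemma dot_commute: "dot x y = dot y x"
  by (simp add: dot_def mult.commute)

lemma dot_add_left: "dot (x + x') y = dot x y + dot x' y"
  by (simp add: dot_def sum.distrib distrib_right)

lemma dot_diff_left: "dot (x - x') y = dot x y - dot x' y"
  for x :: "'a::comm_ring ^ 'n::finite"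
  by (simp add: dot_def sum_subtractf left_diff_distrib)

lemma dot_scale_left: "dot (c *s x) y = c * dot x y"
  by (simp add: dot_def sum_distrib_left mult.assoc)

lemma dot_axis_right: "dot x (axis i c) = x $ i * c"
  for x :: "'a::comm_semiring_1 ^ 'n::finite"
  by (simp add: dot_def axis_def if_distrib cong: if_cong)

lemma dot_diff_right: "dot x (y - y') = dot x y - dot x y'"
  for x :: "'a::comm_ring ^ 'n::finite"
  by (simp add: dot_def sum_subtractf right_diff_distrib)

lemma subspace_dot_eq_0: "vec.subspace {x. dot x y = 0}"
  by (simp add: vec.subspace_def dot_add_left dot_scale_left dot_def[of 0])

text \<open>Each element is uniquely \<open>c *s b + x\<close> with \<open>x\<close> in
  \<open>K\<close>, because a nonzero multiple of \<open>b\<close> inside \<open>K\<close> would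
  force \<open>b\<close> into \<open>K\<close>. The set has the shape produced by
  \<open>vec.span_insert\<close>.\<close>

lemma card_adjoin_line:
  fixes K :: "('a::{field,finite} ^ 'n::finite) set"
  assumes K: "vec.subspace K" and b: "b \<notin> K"
  shows "card {x. \<exists>c. x - c *s b \<in> K} = CARD('a) * card K"
proof -
  have "bij_betw (\<lambda>(c, x). c *s b + x) (UNIV \<times> K) {x. \<exists>c. x - c *s b \<in> K}"
    unfolding bij_betw_def
  proof
    show "inj_on (\<lambda>(c, x). c *s b + x) (UNIV \<times> K)"
    proof (intro inj_onI, clarify)
      fix c c' x x' assume x: "x \<in> K" and x': "x' \<in> K" and eq: "c *s b + x = c' *s b + x'"
      have "(c - c') *s b = c *s b - c' *s b" by (rule vec.scale_left_diff_distrib)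
      also have "\<dots> = x' - x" using eq by (metis add_diff_cancel_left' diff_add_eq diff_diff_eq2)
      finally have mem: "(c - c') *s b \<in> K"
        using vec.subspace_diff[OF K x' x] by (simp only:)
      have "c = c'"
      proof (rule ccontr)
        assume "c \<noteq> c'"
        moreover have "(inverse (c - c') * (c - c')) *s b \<in> K"
          using vec.subspace_scale[OF K mem, of "inverse (c - c')"] by (simp only: vec.scale_scale)
        ultimately show False using b by simp
      qed
      then show "c = c' \<and> x = x'" using eq by simp
    qed
    show "(\<lambda>(c, x). c *s b + x) ` (UNIV \<times> K) = {x. \<exists>c. x - c *s b \<in> K}"
    proof (intro set_eqI iffI)
      fix x assume "x \<in> {x. \<exists>c. x - c *s b \<in> K}"
      then obtain c where "x - c *s b \<in> K" by blast
      then show "x \<in> (\<lambda>(c, x). c *s b + x) ` (UNIV \<times> K)"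
        by (intro image_eqI[of _ _ "(c, x - c *s b)"]) auto
    next
      fix x assume "x \<in> (\<lambda>(c, x). c *s b + x) ` (UNIV \<times> K)"
      then obtain c y where "x = c *s b + y" "y \<in> K" by auto
      then have "x - c *s b \<in> K" by simp
      then show "x \<in> {x. \<exists>c. x - c *s b \<in> K}" by blast
    qed
  qed
  from bij_betw_same_card[OF this] show ?thesis by (simp add: card_cartesian_product)
qed

lemma card_vec_subspace:
  fixes U :: "('a::{field,finite} ^ 'n::finite) set"
  assumes "vec.subspace U"
  shows "card U = CARD('a) ^ vec.dim U"
proof -
  have "card (vec.span B) = CARD('a) ^ card B" if "vec.independent B"
    for B :: "('a ^ 'n) set"
    using finite[of B] that
  proof (induction B rule: finite_induct)
    case (insert b B)
    then have "b \<notin> vec.span B" "vec.independent B" by (auto simp: vec.independent_insert)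
    with insert show ?case
      by (simp add: vec.span_insert card_adjoin_line vec.subspace_span)
  qed (simp)
  moreover obtain B where "vec.independent B" "vec.span B = U" "card B = vec.dim U"
    using assms by (metis vec.basis_exists vec.span_subspace)
  ultimately show ?thesis by metis
qed

text \<open>Any \<open>b\<close> in \<open>U\<close> off the hyperplane splits \<open>U\<close> into
  the line through \<open>b\<close> and the kernel: subtracting the multiple
  \<open>dot x y / dot b y\<close> of \<open>b\<close> moves \<open>x\<close> into the
  kernel.\<close>

lemma card_subspace_Int_hyperplane:
  fixes U :: "('a::{field,finite} ^ 'n::finite) set"
  assumes U: "vec.subspace U" and ne: "\<not> U \<subseteq> {x. dot x y = 0}"
  shows "card U = CARD('a) * card (U \<inter> {x. dot x y = 0})"
proof -
  let ?K = "U \<inter> {x. dot x y = 0}"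
  from ne obtain b where b: "b \<in> U" "dot b y \<noteq> 0" by auto
  have K: "vec.subspace ?K" by (intro vec.subspace_inter U subspace_dot_eq_0)
  have "U = {x. \<exists>c. x - c *s b \<in> ?K}"
  proof (intro set_eqI iffI)
    fix x assume x: "x \<in> U"
    have "dot (x - (dot x y / dot b y) *s b) y = 0"
      using b by (simp add: dot_diff_left dot_scale_left)
    moreover have "x - (dot x y / dot b y) *s b \<in> U"
      using U x b by (simp add: vec.subspace_diff vec.subspace_scale)
    ultimately show "x \<in> {x. \<exists>c. x - c *s b \<in> ?K}" by blast
  next
    fix x assume "x \<in> {x. \<exists>c. x - c *s b \<in> ?K}"
    then obtain c where "x - c *s b \<in> U" by blast
    from vec.subspace_add[OF U this vec.subspace_scale[OF U b(1), of c]] show "x \<in> U" by simp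
  qed
  then show ?thesis using card_adjoin_line[OF K, of b] b by simp
qed

lemma exists_dot_neq_0:
  fixes x :: "'a::field ^ 'n::finite"
  assumes "x \<noteq> 0"
  shows "\<exists>y. dot x y \<noteq> 0"
proof -
  from assms obtain i where "x $ i \<noteq> 0" by (auto simp: vec_eq_iff)
  then have "dot x (axis i 1) \<noteq> 0" by (simp add: dot_axis_right)
  then show ?thesis by blast
qed

lemma exists_dot_separating:
  fixes x x' :: "'a::field ^ 'n::finite"
  assumes x: "x \<noteq> 0" and x': "\<nexists>c. x' = c *s x"
  shows "\<exists>y. dot x y = 0 \<and> dot x' y \<noteq> 0"
proof -
  from x obtain i where i: "x $ i \<noteq> 0" by (auto simp: vec_eq_iff)
  \<comment> \<open>This multiple of \<open>x\<close> agrees with \<open>x'\<close> at coordinate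
    \<open>i\<close>, so they differ at some other \<open>m\<close>. The witness below evaluates on
    \<open>x'\<close> to the nonvanishing 2 by 2 minor on rows \<open>i\<close> and
    \<open>m\<close>.\<close>
  from x' have "x' \<noteq> (x' $ i / x $ i) *s x" by blast
  then obtain m where m: "x' $ m \<noteq> x' $ i / x $ i * x $ m" by (auto simp: vec_eq_iff)
  have "dot x (axis m (x $ i) - axis i (x $ m)) = 0"
    by (simp add: dot_diff_right dot_axis_right)
  moreover have "dot x' (axis m (x $ i) - axis i (x $ m)) \<noteq> 0"
    using i m by (simp add: dot_diff_right dot_axis_right field_simps)
  ultimately show ?thesis by blast
qed

lemma card_orthogonal:
  fixes x :: "'a::{field,finite} ^ 'n::finite"
  assumes "x \<noteq> 0"
  shows "CARD('a) * card {y. dot x y = 0} = CARD('a) ^ CARD('n)"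
  using card_subspace_Int_hyperplane[of UNIV x] exists_dot_neq_0[OF assms]
  by (simp add: dot_commute[of _ x] subset_eq)

lemma card_orthogonal_independent:
  fixes x x' :: "'a::{field,finite} ^ 'n::finite"
  assumes "x \<noteq> 0" "\<nexists>c. x' = c *s x"
  shows "CARD('a)^2 * card {y. dot x y = 0 \<and> dot x' y = 0} = CARD('a) ^ CARD('n)"
proof -
  have "card {y. dot y x = 0} = CARD('a) * card ({y. dot y x = 0} \<inter> {y. dot y x' = 0})"
    using exists_dot_separating[OF assms]
    by (intro card_subspace_Int_hyperplane subspace_dot_eq_0) (auto simp: dot_commute)
  then show ?thesis using card_orthogonal[OF assms(1)]
    by (simp add: dot_commute[of _ x] dot_commute[of _ x'] Int_def power2_eq_square mult.assoc)
qed

section \<open>First and second moments of hyperplane sections\<close>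

text \<open>Double counting of the pairs with \<open>dot x y = 0\<close>. Keeping the trivial
  equation \<open>y = 0\<close> makes the mean exactly \<open>card M / CARD('a)\<close>.\<close>

lemma sum_card_hyperplane:
  fixes M :: "('a::{field,finite} ^ 'n::finite) set"
  assumes "0 \<notin> M"
  shows "CARD('a) * (\<Sum>y\<in>UNIV. card (M \<inter> {x. dot x y = 0})) = card M * CARD('a) ^ CARD('n)"
proof -
  have "(\<Sum>y\<in>UNIV. card (M \<inter> {x. dot x y = 0})) = (\<Sum>y\<in>UNIV. \<Sum>x\<in>M. of_bool (dot x y = 0))"
    by (simp add: of_bool_def sum.If_cases)
  also have "\<dots> = (\<Sum>x\<in>M. card {y. dot x y = 0})"
    by (subst sum.swap) (simp add: of_bool_def sum.If_cases)
  finally have "CARD('a) * (\<Sum>y\<in>UNIV. card (M \<inter> {x. dot x y = 0}))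
      = (\<Sum>x\<in>M. CARD('a) * card {y. dot x y = 0})"
    by (simp add: sum_distrib_left)
  also have "\<dots> = (\<Sum>x\<in>M. CARD('a) ^ CARD('n))"
    using assms by (intro sum.cong card_orthogonal) auto
  finally show ?thesis by simp
qed

text \<open>Double counting of triples. An ordered pair from \<open>M\<close> satisfies two
  independent equations in \<open>y\<close>, unless it is proportional; closure under scaling gives
  exactly \<open>CARD('a) - 1\<close> proportional partners for each \<open>x\<close>, and those
  weigh \<open>CARD('a)\<close> times as much.\<close>

lemma sum_card_hyperplane_square:
  fixes M :: "('a::{field,finite} ^ 'n::finite) set"
  assumes "0 \<notin> M" and scale: "\<And>c x. c \<noteq> 0 \<Longrightarrow> x \<in> M \<Longrightarrow> c *s x \<in> M"
  shows "CARD('a)^2 * (\<Sum>y\<in>UNIV. (card (M \<inter> {x. dot x y = 0}))^2)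
    = card M * (card M + (CARD('a) - 1)^2) * CARD('a) ^ CARD('n)"
proof -
  let ?q = "CARD('a)" and ?Q = "CARD('a) ^ CARD('n)"
  have q: "?q \<ge> 1" by (simp add: Suc_le_eq)
  have inner: "(\<Sum>x'\<in>M. ?q^2 * card {y. dot x y = 0 \<and> dot x' y = 0})
      = (card M + (?q - 1)^2) * ?Q" if x: "x \<in> M" for x
  proof -
    let ?L = "(\<lambda>c. c *s x) ` (UNIV - {0})"
    have x0: "x \<noteq> 0" using x assms(1) by auto
    have "inj (\<lambda>c. c *s x)" using x0 by (intro injI) simp
    then have cL: "card ?L = ?q - 1"
      by (subst card_image) (auto intro: inj_on_subset simp: card_Diff_singleton)
    have L: "?L \<subseteq> M" using scale x by auto
    have "(\<Sum>x'\<in>?L. ?q^2 * card {y. dot x y = 0 \<and> dot x' y = 0}) = (\<Sum>x'\<in>?L. ?q * ?Q)"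
    proof (rule sum.cong)
      fix x' assume "x' \<in> ?L"
      then have "{y. dot x y = 0 \<and> dot x' y = 0} = {y. dot x y = 0}"
        by (auto simp: dot_scale_left)
      then show "?q^2 * card {y. dot x y = 0 \<and> dot x' y = 0} = ?q * ?Q"
        using card_orthogonal[OF x0] by (simp add: power2_eq_square mult.assoc)
    qed simp
    moreover have "(\<Sum>x'\<in>M - ?L. ?q^2 * card {y. dot x y = 0 \<and> dot x' y = 0}) = (\<Sum>x'\<in>M - ?L. ?Q)"
    proof (intro sum.cong card_orthogonal_independent x0)
      fix x' assume x': "x' \<in> M - ?L"
      then have "x' \<noteq> 0" using assms(1) by auto
      then show "\<nexists>c. x' = c *s x" using x' by auto
    qed simp
    ultimately have "(\<Sum>x'\<in>M. ?q^2 * card {y. dot x y = 0 \<and> dot x' y = 0})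
        = (card M - (?q - 1)) * ?Q + (?q - 1) * (?q * ?Q)"
      using sum.subset_diff[OF L, of "\<lambda>x'. ?q^2 * card {y. dot x y = 0 \<and> dot x' y = 0}"] cL
      by (simp add: card_Diff_subset[OF _ L])
    also have "\<dots> = (card M + (?q - 1)^2) * ?Q"
    proof -
      have "?q - 1 \<le> card M" using card_mono[OF _ L] cL by simp
      \<comment> \<open>These substitutions remove the truncated subtractions.\<close>
      then obtain d where d: "card M = ?q - 1 + d" by (auto simp: le_iff_add)
      obtain p where p: "?q = Suc p" using q by (cases ?q) auto
      show ?thesis unfolding d unfolding p by (simp add: algebra_simps power2_eq_square)
    qed
    finally show ?thesis .
  qed
  have "(\<Sum>y\<in>UNIV. (card (M \<inter> {x. dot x y = 0}))^2)
      = (\<Sum>y\<in>UNIV. \<Sum>x\<in>M. \<Sum>x'\<in>M. of_bool (dot x y = 0 \<and> dot x' y = 0))"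
  proof (rule sum.cong)
    fix y
    have "card (M \<inter> {x. dot x y = 0}) = (\<Sum>x\<in>M. of_bool (dot x y = 0))"
      by (simp add: of_bool_def sum.If_cases)
    then show "(card (M \<inter> {x. dot x y = 0}))^2
        = (\<Sum>x\<in>M. \<Sum>x'\<in>M. of_bool (dot x y = 0 \<and> dot x' y = 0))"
      unfolding power2_eq_square sum_product of_bool_conj by (simp only: sum_product)
  qed simp
  also have "\<dots> = (\<Sum>x\<in>M. \<Sum>x'\<in>M. \<Sum>y\<in>UNIV. of_bool (dot x y = 0 \<and> dot x' y = 0))"
    by (subst sum.swap, rule sum.cong[OF refl], subst sum.swap, rule refl)
  also have "\<dots> = (\<Sum>x\<in>M. \<Sum>x'\<in>M. card {y. dot x y = 0 \<and> dot x' y = 0})"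
    by (simp add: of_bool_def sum.If_cases)
  finally have "?q^2 * (\<Sum>y\<in>UNIV. (card (M \<inter> {x. dot x y = 0}))^2)
      = (\<Sum>x\<in>M. \<Sum>x'\<in>M. ?q^2 * card {y. dot x y = 0 \<and> dot x' y = 0})"
    by (simp add: sum_distrib_left)
  also have "\<dots> = (\<Sum>x\<in>M. (card M + (?q - 1)^2) * ?Q)"
    using inner by (intro sum.cong) auto
  finally show ?thesis by simp
qed

section \<open>Subspaces cut out by several equations\<close>

text \<open>
  The equations may be dependent or trivial. This costs nothing, since only the upper bound
  \<open>length ys\<close> on the codimension matters, and it allows averaging over all \<open>y\<close>.
\<close>
definition annihilator :: "('a::field ^ 'n::finite) list \<Rightarrow> ('a ^ 'n) set" where
  "annihilator ys = {x. \<forall>y\<in>set ys. dot x y = 0}"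

lemma annihilator_Nil [simp]: "annihilator [] = UNIV"
  by (simp add: annihilator_def)

lemma annihilator_Cons: "annihilator (y # ys) = annihilator ys \<inter> {x. dot x y = 0}"
  by (auto simp: annihilator_def)

lemma subspace_annihilator: "vec.subspace (annihilator ys)"
  by (induction ys) (simp_all add: annihilator_Cons vec.subspace_inter subspace_dot_eq_0)

text \<open>Each further equation either holds on the whole subspace or divides its size by the
  field size. Truncated subtraction makes the divisor 1 once the equations outnumber the
  dimension.\<close>

lemma power_dvd_card_Int_annihilator:
  fixes W :: "('a::{field,finite} ^ 'n::finite) set"
  assumes W: "vec.subspace W"
  shows "CARD('a) ^ (vec.dim W - length ys) dvd card (W \<inter> annihilator ys)"
proof (induction ys)
  case Nil
  then show ?case using card_vec_subspace[OF W] by simp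
next
  case (Cons y ys)
  let ?q = "CARD('a)" and ?U = "W \<inter> annihilator ys" and ?d = "vec.dim W - length ys"
  have U: "vec.subspace ?U" by (intro vec.subspace_inter W subspace_annihilator)
  have *: "?q ^ (?d - 1) dvd ?q ^ ?d" by (rule le_imp_power_dvd) simp
  have "?q ^ (?d - 1) dvd card (?U \<inter> {x. dot x y = 0})"
  proof (cases "?U \<subseteq> {x. dot x y = 0} \<or> ?d = 0")
    case True
    then show ?thesis using dvd_trans[OF * Cons.IH] by (auto simp: Int_absorb2)
  next
    case False
    then have "?q * ?q ^ (?d - 1) dvd ?q * card (?U \<inter> {x. dot x y = 0})"
      using card_subspace_Int_hyperplane[OF U, of y] Cons.IH
      by (metis power_eq_if)
    then show ?thesis by simp
  qed
  then show ?case by (simp add: annihilator_Cons Int_assoc)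
qed

section \<open>Number of uncovered vectors in a subspace\<close>

definition holes :: "('a::zero) set set \<Rightarrow> 'a set" where
  "holes P = {x. x \<noteq> 0 \<and> x \<notin> \<Union>P}"

text \<open>The nonzero vectors of \<open>U\<close> split into the holes and the disjoint traces of
  the spread elements; each \<open>- 1\<close> removes a zero vector.\<close>

lemma card_holes_Int:
  fixes P :: "('a::{field,finite} ^ 'n::finite) set set"
  assumes P: "partial_spread k P" and U: "vec.subspace U"
  shows "int (card (holes P \<inter> U)) = int (card U) - 1 - (\<Sum>W\<in>P. int (card (W \<inter> U)) - 1)"
proof -
  let ?N = "\<lambda>W. W \<inter> U - {0}"
  have zero: "0 \<in> U" using U by (rule vec.subspace_0)
  have zeroW: "0 \<in> W" if "W \<in> P" for W
    using P that by (simp add: partial_spread_def vec.subspace_0)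
  have cardN: "int (card (?N W)) = int (card (W \<inter> U)) - 1" if "W \<in> P" for W
  proof -
    have "card (W \<inter> U) > 0" using zero zeroW[OF that] by (auto simp: card_gt_0_iff)
    then show ?thesis using zero zeroW[OF that] by (simp add: card_Diff_singleton of_nat_diff)
  qed
  have "card (\<Union>W\<in>P. ?N W) = (\<Sum>W\<in>P. card (?N W))"
    using P by (intro card_UN_disjoint) (auto simp: partial_spread_def pairwise_def)
  then have 1: "int (card (\<Union>W\<in>P. ?N W)) = (\<Sum>W\<in>P. int (card (W \<inter> U)) - 1)"
    using cardN by simp
  have "U = insert 0 ((holes P \<inter> U) \<union> (\<Union>W\<in>P. ?N W))"
    using zero by (auto simp: holes_def)
  then have "card U = card (insert 0 ((holes P \<inter> U) \<union> (\<Union>W\<in>P. ?N W)))" by simp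
  also have "\<dots> = Suc (card ((holes P \<inter> U) \<union> (\<Union>W\<in>P. ?N W)))"
    by (subst card_insert_disjoint) (auto simp: holes_def)
  also have "card ((holes P \<inter> U) \<union> (\<Union>W\<in>P. ?N W)) = card (holes P \<inter> U) + card (\<Union>W\<in>P. ?N W)"
    by (rule card_Un_disjoint) (auto simp: holes_def)
  finally show ?thesis using 1 by simp
qed

lemma power_minus_one_dvd: "(b - 1 :: int) dvd b ^ n - 1"
  by (simp add: power_diff_1_eq)

lemma card_holes_dvd:
  fixes P :: "('a::{field,finite} ^ 'n::finite) set set"
  assumes P: "partial_spread k P" and U: "vec.subspace U"
  shows "int CARD('a) - 1 dvd int (card (holes P \<inter> U))"
proof -
  have *: "int CARD('a) - 1 dvd int (card W) - 1" if "vec.subspace W" for W :: "('a ^ 'n) set"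
    using power_minus_one_dvd[of "int CARD('a)"] card_vec_subspace[OF that] by simp
  have "int CARD('a) - 1 dvd (\<Sum>W\<in>P. int (card (W \<inter> U)) - 1)"
  proof (rule dvd_sum)
    fix W assume "W \<in> P"
    then have "vec.subspace W" using P by (simp add: partial_spread_def)
    then show "int CARD('a) - 1 dvd int (card (W \<inter> U)) - 1" by (intro * vec.subspace_inter U)
  qed
  from dvd_diff[OF *[OF U] this] show ?thesis unfolding card_holes_Int[OF P U] .
qed

text \<open>Modulo this power the sizes of \<open>annihilator ys\<close> and of all its
  intersections with spread elements vanish, so only the constants \<open>- 1\<close> and
  \<open>card P\<close> survive.\<close>

lemma card_holes_cong:
  fixes P :: "('a::{field,finite} ^ 'n::finite) set set"
  assumes P: "partial_spread k P" and k: "k \<le> CARD('n)"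
  shows "[int (card (holes P \<inter> annihilator ys)) = int (card P) - 1]
    (mod int CARD('a) ^ (k - length ys))"
proof -
  let ?m = "int CARD('a) ^ (k - length ys)" and ?U = "annihilator ys"
  have *: "?m dvd int (card (W \<inter> ?U))" if "vec.subspace W" "k \<le> vec.dim W" for W :: "('a ^ 'n) set"
  proof -
    have "CARD('a) ^ (k - length ys) dvd CARD('a) ^ (vec.dim W - length ys)"
      using that by (intro le_imp_power_dvd) simp
    also note power_dvd_card_Int_annihilator[OF that(1)]
    finally show ?thesis by (metis of_nat_dvd_iff of_nat_power)
  qed
  have "?m dvd int (card (UNIV \<inter> ?U))"
    by (rule *) (use k in \<open>simp_all add: vec.dim_UNIV card_cart_basis\<close>)
  moreover have "?m dvd (\<Sum>W\<in>P. int (card (W \<inter> ?U)))"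
    using P by (intro dvd_sum *) (auto simp: partial_spread_def)
  ultimately have "?m dvd int (card ?U) - (\<Sum>W\<in>P. int (card (W \<inter> ?U)))"
    by simp
  then show ?thesis
    unfolding card_holes_Int[OF P subspace_annihilator] cong_iff_dvd_diff
    by (simp add: sum_subtractf)
qed

lemma card_holes_form:
  fixes P :: "('a::{field,finite} ^ 'n::finite) set set"
  assumes P: "partial_spread k P" and k: "k \<le> CARD('n)"
    and w: "[w = int (card P) - 1] (mod int CARD('a) ^ k)" and w1: "[w = 1] (mod int CARD('a) - 1)"
  shows "\<exists>a. int (card (holes P \<inter> annihilator ys))
    = w + (a * (int CARD('a) - 1) - 1) * int CARD('a) ^ (k - length ys)"
proof -
  let ?q = "int CARD('a)" and ?X = "int (card (holes P \<inter> annihilator ys))"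
  let ?m = "?q ^ (k - length ys)"
  have "[w = int (card P) - 1] (mod ?m)"
    using w by (rule cong_dvd_modulus) (intro le_imp_power_dvd, simp)
  with card_holes_cong[OF P k, of ys] have "[?X = w] (mod ?m)"
    by (metis cong_sym cong_trans)
  then obtain b where b: "?X - w = ?m * b" by (auto simp: cong_iff_dvd_diff)
  \<comment> \<open>Every summand except \<open>b + 1\<close> is visibly divisible by
    \<open>?q - 1\<close>.\<close>
  have "?X = w - 1 + (?m - 1) * b + (b + 1)" using b by (simp add: algebra_simps)
  moreover have "?q - 1 dvd ?X" "?q - 1 dvd w - 1" "?q - 1 dvd (?m - 1) * b"
    using card_holes_dvd[OF P subspace_annihilator] w1 power_minus_one_dvd[of ?q]
    by (auto simp: cong_iff_dvd_diff)
  ultimately have "?q - 1 dvd b + 1"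
    by (metis dvd_add_right_iff dvd_add)
  then obtain a where "b + 1 = (?q - 1) * a" by auto
  then have "b = a * (?q - 1) - 1" by (simp add: algebra_simps)
  with b have "?X = w + (a * (?q - 1) - 1) * ?m" by (simp add: algebra_simps)
  then show ?thesis by blast
qed

section \<open>Descent to a subspace with few holes\<close>

lemma exists_hyperplane_le_average:
  fixes M :: "('a::{field,finite} ^ 'n::finite) set"
  assumes "0 \<notin> M"
  shows "\<exists>y. CARD('a) * card (M \<inter> {x. dot x y = 0}) \<le> card M"
proof (rule ccontr)
  assume "\<not> ?thesis"
  then have "(\<Sum>y\<in>(UNIV :: ('a ^ 'n) set). card M)
      < (\<Sum>y\<in>UNIV. CARD('a) * card (M \<inter> {x. dot x y = 0}))"
    by (intro sum_strict_mono) (auto simp: not_le)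
  then show False using sum_card_hyperplane[OF assms] by (simp add: sum_distrib_left)
qed

lemma card_field_ge_2: "CARD('a::{field,finite}) \<ge> 2"
  using card_mono[of "UNIV :: 'a set" "{0, 1}"] by simp

lemma zero_notin_holes [simp]: "0 \<notin> holes P"
  by (simp add: holes_def)

lemma exists_annihilator_few_holes:
  fixes P :: "('a::{field,finite} ^ 'n::finite) set set"
  assumes P: "partial_spread k P" and k: "k \<le> CARD('n)"
    and w: "[w = int (card P) - 1] (mod int CARD('a) ^ k)" and w1: "[w = 1] (mod int CARD('a) - 1)"
    and "w > 0" and init: "int (card (holes P)) = w + (a * (int CARD('a) - 1) - 1) * int CARD('a) ^ k"
    and "j \<le> k"
  shows "\<exists>ys b. length ys = j \<and> b \<le> a - int j \<and>
    int (card (holes P \<inter> annihilator ys))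
      = w + (b * (int CARD('a) - 1) - 1) * int CARD('a) ^ (k - j)"
  using \<open>j \<le> k\<close>
proof (induction j)
  case 0
  then show ?case using init by (intro exI[of _ "[]"] exI[of _ a]) simp
next
  case (Suc j)
  let ?q = "int CARD('a)"
  have q: "?q \<ge> 2" using card_field_ge_2[where 'a='a] by linarith
  from Suc obtain ys b where ys: "length ys = j" and b: "b \<le> a - int j"
    and X: "int (card (holes P \<inter> annihilator ys)) = w + (b * (?q - 1) - 1) * ?q ^ (k - j)"
    by auto
  obtain y where "CARD('a) * card (holes P \<inter> annihilator ys \<inter> {x. dot x y = 0})
      \<le> card (holes P \<inter> annihilator ys)"
    using exists_hyperplane_le_average[of "holes P \<inter> annihilator ys"] by auto
  then have le: "?q * int (card (holes P \<inter> annihilator (y # ys)))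
      \<le> int (card (holes P \<inter> annihilator ys))"
    by (simp add: annihilator_Cons Int_assoc flip: of_nat_mult)
  obtain c where c: "int (card (holes P \<inter> annihilator (y # ys)))
      = w + (c * (?q - 1) - 1) * ?q ^ (k - Suc j)"
    using card_holes_form[OF P k w w1, of "y # ys"] ys by auto
  have kj: "?q ^ (k - j) = ?q * ?q ^ (k - Suc j)"
    using Suc.prems by (simp add: Suc_diff_Suc flip: power_Suc)
  \<comment> \<open>Averaging alone gives a weak inequality. As \<open>w\<close> is positive,
    replacing \<open>w\<close> by \<open>?q * w\<close> makes it strict, so the integer coefficient
    falls by at least one.\<close>
  have "w < ?q * w" using q \<open>w > 0\<close> by simp
  moreover have "?q * w + (c * (?q - 1) - 1) * ?q ^ (k - j) \<le> w + (b * (?q - 1) - 1) * ?q ^ (k - j)"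
    using le unfolding X c kj by (simp add: algebra_simps)
  ultimately have "(c * (?q - 1) - 1) * ?q ^ (k - j) < (b * (?q - 1) - 1) * ?q ^ (k - j)"
    by linarith
  then have "c * (?q - 1) < b * (?q - 1)"
    using q by (simp add: mult_less_cancel_right)
  then have "c < b" using q by (simp add: mult_less_cancel_right)
  then show ?case using ys b c by (intro exI[of _ "y # ys"] exI[of _ c]) auto
qed

section \<open>The quadratic estimate\<close>

text \<open>After cancelling positive factors, the averaged quadratic says
  \<open>card M >= w * (CARD('a) * D - w)\<close>; inserting the form of \<open>card M\<close> gives
  the stated inequality.\<close>

lemma hyperplane_second_moment_bound:
  fixes M :: "('a::{field,finite} ^ 'n::finite) set"
  assumes M0: "0 \<notin> M" and scale: "\<And>c x. c \<noteq> 0 \<Longrightarrow> x \<in> M \<Longrightarrow> c *s x \<in> M"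
    and X: "int (card M) = w + (a * (int CARD('a) - 1) - 1) * (int CARD('a) * D)"
    and f: "\<And>y. \<exists>b. int (card (M \<inter> {x. dot x y = 0})) = w + (b * (int CARD('a) - 1) - 1) * D"
  shows "int CARD('a) * D * (w + 1 - a * (int CARD('a) - 1)) \<le> w * (w + 1)"
proof -
  let ?q = "int CARD('a)" and ?X = "int (card M)"
  let ?f = "\<lambda>y. int (card (M \<inter> {x. dot x y = 0}))" and ?Q = "int CARD('a) ^ CARD('n)"
  \<comment> \<open>\<open>A\<close> and \<open>B\<close> are consecutive possible values of \<open>?f\<close>. They enclose its mean \<open>?X / ?q\<close> if \<open>0 \<le> w \<le> ?q * D\<close>.\<close>
  define A where "A = w + (a * (?q - 1) - 1) * D"
  define B where "B = A - (?q - 1) * D"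
  have q: "?q \<ge> 2" using card_field_ge_2[where 'a='a] by linarith
  have nonneg: "(?f y - A) * (?f y - B) \<ge> 0" for y
  proof -
    obtain b where b: "?f y = w + (b * (?q - 1) - 1) * D" using f by blast
    \<comment> \<open>The two factors are \<open>b - a\<close> and \<open>b - a + 1\<close> times
      the lattice step, and a product of consecutive integers is nonnegative.\<close>
    have "(?f y - A) * (?f y - B) = ((b - a) * (b - a + 1)) * ((?q - 1) * D)\<^sup>2"
      unfolding b A_def B_def by (simp add: algebra_simps power2_eq_square)
    moreover have "(b - a) * (b - a + 1) \<ge> 0"
      by (cases "b \<ge> a") (auto intro: mult_nonpos_nonpos)
    ultimately show ?thesis by simp
  qed
  have S1: "?q * (\<Sum>y\<in>UNIV. ?f y) = ?X * ?Q"
    using arg_cong[OF sum_card_hyperplane[OF M0], of int] by simp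
  have S2: "?q\<^sup>2 * (\<Sum>y\<in>UNIV. (?f y)\<^sup>2) = ?X * (?X + (?q - 1)\<^sup>2) * ?Q"
    using arg_cong[OF sum_card_hyperplane_square[OF M0 scale], of int] q by (simp add: of_nat_diff)
  \<comment> \<open>The factor \<open>?q\<^sup>2\<close> lets both moments be substituted without
    division.\<close>
  have "0 \<le> ?q\<^sup>2 * (\<Sum>y\<in>UNIV. (?f y - A) * (?f y - B))"
    by (intro mult_nonneg_nonneg sum_nonneg nonneg) simp
  also have "(\<Sum>y\<in>UNIV. (?f y - A) * (?f y - B))
      = (\<Sum>y\<in>UNIV. (?f y)\<^sup>2 - (A + B) * ?f y + A * B)"
    by (intro sum.cong refl) (simp add: algebra_simps power2_eq_square)
  also have "\<dots> = (\<Sum>y\<in>UNIV. (?f y)\<^sup>2) - (A + B) * (\<Sum>y\<in>UNIV. ?f y) + ?Q * (A * B)"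
    by (simp add: sum.distrib sum_subtractf sum_distrib_left)
  also have "?q\<^sup>2 * \<dots> = ?q\<^sup>2 * (\<Sum>y\<in>UNIV. (?f y)\<^sup>2) - ?q * (A + B) * (?q * (\<Sum>y\<in>UNIV. ?f y))
      + ?q\<^sup>2 * ?Q * (A * B)"
    by (simp add: algebra_simps power2_eq_square)
  also have "\<dots> = ?Q * ((?X - ?q * A) * (?X - ?q * B) + (?q - 1)\<^sup>2 * ?X)"
    unfolding S1 S2 by (simp add: algebra_simps power2_eq_square)
  also have "?X - ?q * A = - ((?q - 1) * w)"
    unfolding X A_def by (simp add: algebra_simps)
  also have "?X - ?q * B = (?q - 1) * (?q * D - w)"
    unfolding X A_def B_def by (simp add: algebra_simps)
  also have "- ((?q - 1) * w) * ((?q - 1) * (?q * D - w)) + (?q - 1)\<^sup>2 * ?X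
      = (?q - 1)\<^sup>2 * (?X - w * (?q * D - w))"
    by (simp add: algebra_simps power2_eq_square)
  finally have "0 \<le> (?Q * (?q - 1)\<^sup>2) * (?X - w * (?q * D - w))"
    by (simp only: mult.assoc)
  moreover have "?Q * (?q - 1)\<^sup>2 > 0" using q by (intro mult_pos_pos) auto
  ultimately have "0 \<le> ?X - w * (?q * D - w)"
    by (simp only: zero_le_mult_iff) linarith
  then show ?thesis unfolding X by (simp add: algebra_simps)
qed

section \<open>The competing binomial estimate\<close>

text \<open>The binomial expansion truncated after the quadratic term, doubled to stay in the
  integers. The induction step discards a nonnegative cubic term.\<close>

lemma two_times_power_ge:
  fixes x :: int
  assumes "x \<ge> 0"
  shows "2 + 2 * int n * x + int n * (int n - 1) * x\<^sup>2 \<le> 2 * (1 + x) ^ n"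
proof (induction n)
  case (Suc n)
  have "int n * (int n - 1) * x ^ 3 \<ge> 0"
    using assms by (cases n) auto
  then have "2 + 2 * int (Suc n) * x + int (Suc n) * (int (Suc n) - 1) * x\<^sup>2
      \<le> (2 + 2 * int n * x + int n * (int n - 1) * x\<^sup>2) * (1 + x)"
    by (simp add: algebra_simps power2_eq_square power3_eq_cube)
  also have "\<dots> \<le> 2 * (1 + x) ^ n * (1 + x)"
    using Suc assms by (intro mult_right_mono) auto
  finally show ?case by (simp add: algebra_simps)
qed simp

text \<open>With \<open>x = q - 1\<close> the left side is \<open>w * (w + 1)\<close>. The truncated
  expansion exceeds it by \<open>x * (2 + z * (x - 1))\<close>.\<close>

lemma linear_times_linear_less_power:
  fixes x :: int
  assumes "x \<ge> 1"
  shows "(1 + int z * x) * (1 + int z * x + 1) < 2 * (1 + x) ^ Suc z"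
proof -
  have "int z * x * (x - 1) \<ge> 0" using assms by simp
  then have "x * (2 + int z * (x - 1)) > 0"
    using assms by (intro mult_pos_pos) (auto intro: add_pos_nonneg)
  then have "(1 + int z * x) * (1 + int z * x + 1)
      < 2 + 2 * int (Suc z) * x + int (Suc z) * (int (Suc z) - 1) * x\<^sup>2"
    by (simp add: algebra_simps power2_eq_square)
  also have "\<dots> \<le> 2 * (1 + x) ^ Suc z"
    using assms by (intro two_times_power_ge) simp
  finally show ?thesis .
qed

section \<open>Excluding one size, and the final bound\<close>

lemma scale_mem_holes:
  fixes P :: "('a::{field,finite} ^ 'n::finite) set set"
  assumes "partial_spread k P" "c \<noteq> 0" "x \<in> holes P"
  shows "c *s x \<in> holes P"
proof -
  have "x \<in> W" if "W \<in> P" "c *s x \<in> W" for W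
  proof -
    have "vec.subspace W" using assms(1) that(1) by (simp add: partial_spread_def)
    from vec.subspace_scale[OF this that(2)] have "inverse c *s (c *s x) \<in> W" .
    then show ?thesis using \<open>c \<noteq> 0\<close> by (simp only: vec.scale_scale) simp
  qed
  then show ?thesis using assms by (auto simp: holes_def)
qed

text \<open>An exact size, one above the claimed bound, is excluded because the congruences depend
  on \<open>card P\<close>; larger spreads are reduced to it by passing to subsets. All hypotheses
  are integral, with \<open>L\<close> in the role of \<open>l\<close>.\<close>

lemma partial_spread_card_neq:
  fixes P :: "('a::{field,finite} ^ 'n::finite) set set"
  assumes P: "partial_spread k P" and v: "CARD('n) = k * t + r" "t \<ge> 1"
    and z: "z < k" and g: "(int CARD('a) - 1) * a = int CARD('a) ^ r - 1 - int z * (int CARD('a) - 1)"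
    and a: "a < int k"
    and L: "int L * (int CARD('a) ^ k - 1) = int CARD('a) ^ (CARD('n) - k) - int CARD('a) ^ r"
  shows "card P \<noteq> L * CARD('a) ^ k + 2 + z * (CARD('a) - 1)"
proof
  let ?q = "int CARD('a)" and ?v = "CARD('n)"
  define w where "w = 1 + int z * (?q - 1)"
  have q: "?q \<ge> 2" using card_field_ge_2[where 'a='a] by linarith
  have k: "k \<le> ?v" using v by (cases t) auto
  have "w > 0" using q by (auto simp: w_def intro: add_pos_nonneg)
  assume "card P = L * CARD('a) ^ k + 2 + z * (CARD('a) - 1)"
  then have card: "int (card P) = int L * ?q ^ k + 1 + w"
    using q by (simp add: w_def of_nat_diff)
  have w: "[w = int (card P) - 1] (mod ?q ^ k)"
    by (simp add: card cong_iff_dvd_diff)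
  have w1: "[w = 1] (mod ?q - 1)"
    by (simp add: w_def cong_iff_dvd_diff)
  have "int (card (holes P)) = ?q ^ ?v - 1 - int (card P) * (?q ^ k - 1)"
  proof -
    have "card W = CARD('a) ^ k" if "W \<in> P" for W
      using P that card_vec_subspace[of W] by (simp add: partial_spread_def)
    then have "(\<Sum>W\<in>P. int (card (W \<inter> UNIV)) - 1) = int (card P) * (?q ^ k - 1)" by simp
    with card_holes_Int[OF P vec.subspace_UNIV] show ?thesis by simp
  qed
  also have "\<dots> = w + (a * (?q - 1) - 1) * ?q ^ k"
  proof -
    \<comment> \<open>Eliminating \<open>?q ^ (?v - k)\<close> through \<open>L\<close> cancels all
      terms with \<open>L\<close>; then \<open>?q ^ r = w + a * (?q - 1)\<close> yields the
      coefficient \<open>a\<close>.\<close>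
    have "?q ^ ?v = ?q ^ k * ?q ^ (?v - k)" using k by (simp flip: power_add)
    also have "?q ^ (?v - k) = int L * (?q ^ k - 1) + ?q ^ r" using L by simp
    finally have 1: "?q ^ ?v = ?q ^ k * (int L * (?q ^ k - 1) + ?q ^ r)" .
    have 2: "a * (?q - 1) = ?q ^ r - w" using g by (simp add: w_def algebra_simps)
    show ?thesis unfolding card 1 2 by (simp add: algebra_simps)
  qed
  \<comment> \<open>This many equations leave the exponent \<open>Suc z\<close>, so that one more
    equation leaves \<open>z\<close>; and \<open>a <= k - 1\<close> then forces
    \<open>b <= z\<close>.\<close>
  finally obtain ys b where ys: "length ys = k - 1 - z" and b: "b \<le> a - int (k - 1 - z)"
    and X: "int (card (holes P \<inter> annihilator ys)) = w + (b * (?q - 1) - 1) * ?q ^ (k - (k - 1 - z))"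
    using exists_annihilator_few_holes[OF P k w w1 \<open>w > 0\<close>, of a "k - 1 - z"] by auto
  have "k - (k - 1 - z) = Suc z" using z by simp
  note X = X[unfolded this power_Suc]
  have "?q * ?q ^ z * (w + 1 - b * (?q - 1)) \<le> w * (w + 1)"
  proof (rule hyperplane_second_moment_bound[OF _ _ X])
    show "c *s x \<in> holes P \<inter> annihilator ys" if "c \<noteq> 0" "x \<in> holes P \<inter> annihilator ys" for c x
      using that scale_mem_holes[OF P] vec.subspace_scale[OF subspace_annihilator] by blast
    show "\<exists>b. int (card (holes P \<inter> annihilator ys \<inter> {x. dot x y = 0})) = w + (b * (?q - 1) - 1) * ?q ^ z" for y
    proof -
      have "k - length (y # ys) = z" using ys z by simp
      then show ?thesis
        using card_holes_form[OF P k w w1, of "y # ys"] by (simp add: annihilator_Cons Int_assoc)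
    qed
  qed simp
  moreover have "w * (w + 1) < 2 * (?q * ?q ^ z)"
    using linear_times_linear_less_power[of "?q - 1" z] q by (simp add: w_def)
  moreover have "?q * ?q ^ z * 2 \<le> ?q * ?q ^ z * (w + 1 - b * (?q - 1))"
  proof (rule mult_left_mono)
    have "b \<le> int z" using a b z by linarith
    then have "b * (?q - 1) \<le> int z * (?q - 1)" using q by (intro mult_right_mono) auto
    then show "2 \<le> w + 1 - b * (?q - 1)" by (simp add: w_def)
  qed simp
  ultimately show False by linarith
qed

lemma partial_spread_subset: "partial_spread k P \<Longrightarrow> Q \<subseteq> P \<Longrightarrow> partial_spread k Q"
  by (auto simp: partial_spread_def intro: pairwise_subset)

theorem theorem9:
  fixes q r t u z k v :: nat and l :: real
  assumes "q = CARD('a::{field,finite})"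
    and "v = CARD('n::finite)"
    and "r \<ge> 1" and "t \<ge> 2"
    and "real z \<le> (real q ^ r - 1) / (2 * (real q - 1))"
    and "real k = (real q ^ r - 1) / (real q - 1) + 1 - real z + real u"
    and "k > r"
    and "v = k * t + r"
    and "l = (real q ^ (v - k) - real q ^ r) / (real q ^ k - 1)"
  shows "real (max_partial_spread TYPE('a ^ 'n) k) \<le> l * real q ^ k + 1 + real z * (real q - 1)"
proof (rule ccontr)
  assume contra: "\<not> ?thesis"
  have q: "q \<ge> 2" unfolding assms(1) by (rule card_field_ge_2)
  define h where "h = (real q ^ r - 1) / (real q - 1)"
  \<comment> \<open>By \<open>ha\<close> this is the integer \<open>h - z\<close>; defining it
    through \<open>k\<close> and \<open>u\<close> avoids a separate proof that \<open>h\<close> is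
    an integer.\<close>
  define a where "a = int k - 1 - int u"
  have hz: "2 * real z \<le> h" using assms(5) q by (simp add: h_def field_simps)
  have kh: "real k = h + 1 - real z + real u" using assms(6) by (simp add: h_def)
  then have ha: "of_int a = h - real z" by (simp add: a_def)
  have "real z < real k" using hz kh by linarith
  then have zk: "z < k" by simp
  have "(real q - 1) * of_int a = real q ^ r - 1 - real z * (real q - 1)"
    using q unfolding ha by (simp add: h_def field_simps)
  then have "of_int ((int q - 1) * a) = (of_int (int q ^ r - 1 - int z * (int q - 1)) :: real)"
    by simp
  then have g: "(int q - 1) * a = int q ^ r - 1 - int z * (int q - 1)"
    by (simp only: of_int_eq_iff)
  obtain t' where t': "t = Suc t'" using assms(4) by (cases t) auto
  have vk: "v - k = k * t' + r" using assms(8) t' by simp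
  \<comment> \<open>The numerator of \<open>l\<close> is \<open>q ^ r\<close> times
    \<open>(q ^ k) ^ t' - 1\<close>, so \<open>l\<close> is a natural number, called
    \<open>L\<close> below.\<close>
  have "int q ^ k - 1 dvd (int q ^ k) ^ t' - 1" by (rule power_minus_one_dvd)
  then obtain L' where L': "(int q ^ k) ^ t' - 1 = (int q ^ k - 1) * L'" by blast
  have qk: "int q ^ k > 1" using q assms(7) by (intro one_less_power) auto
  have "(int q ^ k - 1) * L' \<ge> 0" unfolding L'[symmetric] using q by simp
  then have "L' \<ge> 0" using qk by (simp add: zero_le_mult_iff)
  define L where "L = nat (L' * int q ^ r)"
  have "int L = L' * int q ^ r" using \<open>L' \<ge> 0\<close> by (simp add: L_def)
  then have "int L * (int q ^ k - 1) = ((int q ^ k) ^ t' - 1) * int q ^ r"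
    unfolding L' by simp
  then have L: "int L * (int q ^ k - 1) = int q ^ (v - k) - int q ^ r"
    by (simp add: vk power_add power_mult algebra_simps)
  have "of_int (int L * (int q ^ k - 1)) = (of_int (int q ^ (v - k) - int q ^ r) :: real)"
    unfolding L ..
  then have "real L * (real q ^ k - 1) = real q ^ (v - k) - real q ^ r" by simp
  moreover have "real q ^ k > 1" using q assms(7) by (intro one_less_power) auto
  ultimately have l: "l = real L" unfolding assms(9) by (simp add: field_simps)

  let ?\<P> = "{P :: ('a ^ 'n) set set. partial_spread k P}"
  have "Max (card ` ?\<P>) \<in> card ` ?\<P>"
    using partial_spread_empty finite_partial_spreads by (intro Max_in) auto
  then obtain P :: "('a ^ 'n) set set" where P: "partial_spread k P"
    and max: "card P = max_partial_spread TYPE('a ^ 'n) k"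
    by (auto simp: max_partial_spread_def)
  have "real (card P) > real (L * q ^ k + 1 + z * (q - 1))"
    using contra q by (simp add: max l of_nat_diff)
  \<comment> \<open>Both sides are natural numbers, so exceeding the bound means exceeding it by at
    least one. A subset of exactly that size is again a partial spread.\<close>
  then have "L * q ^ k + 2 + z * (q - 1) \<le> card P" by linarith
  then obtain R where "R \<subseteq> P" "card R = L * q ^ k + 2 + z * (q - 1)"
    by (meson obtain_subset_with_card_n)
  moreover have "card R \<noteq> L * q ^ k + 2 + z * (q - 1)"
    unfolding assms(1)
  proof (rule partial_spread_card_neq)
    show "partial_spread k R" using P \<open>R \<subseteq> P\<close> by (rule partial_spread_subset)
    show "CARD('n) = k * t + r" "1 \<le> t" using assms(2,4,8) by auto
    show "z < k" by (rule zk)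
    show "a < int k" by (simp add: a_def)
  qed (use g L in \<open>simp_all only: assms(1,2)\<close>)
  ultimately show False by simp
qed

end
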